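(* Let $\mathbf{G}$ be a spray on an $n$-dimensional manifold $M$. Then $\mathbf{G}$ is projectively Ricci-flat if and only if there are a volume form $dV$ and a scalar function $f$ on $M$ such that, on $TM\setminus\{0\}$, $$\mathbf{Ric}_{\mathbf{G}} = -(n-1)\Big\{\Xi_{|0}+\Xi^2\Big\},$$ where $\Xi := \frac{\mathbf{S}}{n+1}-f_0$, $\mathbf{S}=\mathbf{S}_{(\mathbf{G},dV)}$ is the S-curvature of $(\mathbf{G},dV)$, $f_0 = f_{x^m}y^m$, and "$|$" is the horizontal covariant derivative with respect to $\mathbf{G}$.
   Context: Let $M$ be an $n$-dimensional smooth manifold, $(x^i)$ local coordinates on $M$ and $(x^i,y^i)$ the induced coordinates on $TM$; repeated indices are summed. A spray $\mathbf{G}$ on $M$ is a smooth vector field on the slit tangent bundle $TM_0=TM\setminus\{0\}$ which in every standard local coordinate system has the form $\mathbf{G}=y^i\frac{\partial}{\partial x^i}-2G^i(x,y)\frac{\partial}{\partial y^i}$ with $G^i(x,\lambda y)=\lambda^2G^i(x,y)$ for all $\lambda>0$. Its Riemann curvature is $$R^i_{\ k}=2\frac{\partial G^i}{\partial x^k}-y^j\frac{\partial^2G^i}{\partial x^j\partial y^k}+2G^j\frac{\partial^2G^i}{\partial y^j\partial y^k}-\frac{\partial G^i}{\partial y^s}\frac{\partial G^s}{\partial y^k},$$ and its Ricci curvature is $\mathbf{Ric}_{\mathbf{G}}:=R^m_{\ m}$, a function on $TM_0$. A volume form on $M$ is written locally as $dV=\sigma(x)\,dx^1\cdots dx^n$ with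 $\sigma>0$ smooth. The S-curvature of $(\mathbf{G},dV)$ is the function on $TM_0$ given by $\mathbf{S}_{(\mathbf{G},dV)}:=\frac{\partial G^m}{\partial y^m}-y^m\frac{\partial}{\partial x^m}(\ln\sigma)$. The projective spray of $(\mathbf{G},dV)$ is $\hat{\mathbf{G}}:=\mathbf{G}+\frac{2\mathbf{S}}{n+1}\mathbf{Y}$ with $\mathbf{Y}=y^i\frac{\partial}{\partial y^i}$, i.e. $\hat G^i=G^i-\frac{\mathbf{S}}{n+1}y^i$. The projective Ricci curvature is $\mathbf{PRic}_{(\mathbf{G},dV)}:=\mathbf{Ric}_{\hat{\mathbf{G}}}$. The spray $\mathbf{G}$ is called projectively Ricci-flat if there is a volume form $dV$ on $M$ such that $\mathbf{PRic}_{(\mathbf{G},dV)}=0$. For a function $\Phi$ on $TM_0$, $\Phi_{|0}$ denotes the horizontal covariant derivative of $\Phi$ contracted with $y$, i.e. the derivative along geodesics of $\mathbf{G}$: $\Phi_{|0}=\mathbf{G}(\Phi)=y^m\frac{\partial\Phi}{\partial x^m}-2G^m\frac{\partial\Phi}{\partial y^m}$. For a smooth scalar function $f=f(x)$ on $M$, $f_0:=\frac{\partial f}{\partial x^m}y^m$. *)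

theory Defs
  imports "HOL-Analysis.Analysis"
begin

subsection \<open>Smooth maps and partial derivatives\<close>

primrec Ck_on :: "nat \<Rightarrow> ('e::real_normed_vector \<Rightarrow> 'f::real_normed_vector) \<Rightarrow> 'e set \<Rightarrow> bool" where
  "Ck_on 0 f S \<longleftrightarrow> continuous_on S f"
| "Ck_on (Suc k) f S \<longleftrightarrow>
     (\<forall>x\<in>S. f differentiable (at x)) \<and> (\<forall>v. Ck_on k (\<lambda>x. frechet_derivative f (at x) v) S)"

text \<open>Only used on open sets \<open>S\<close>, where this is \<open>C\<^sup>\<infinity>\<close> in the usual sense.\<close>

definition smooth_on :: "'e::real_normed_vector set \<Rightarrow> ('e \<Rightarrow> 'f::real_normed_vector) \<Rightarrow> bool" where
  "smooth_on S f \<longleftrightarrow> (\<forall>k. Ck_on k f S)"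

definition partial :: "'n::finite \<Rightarrow> (real^'n \<Rightarrow> real) \<Rightarrow> real^'n \<Rightarrow> real" where
  "partial k h x = frechet_derivative h (at x) (axis k 1)"


subsection \<open>Charts, manifolds, vector fields\<close>

text \<open>A chart is a pair of its domain and its coordinate map; values of the
  coordinate map outside the domain are irrelevant.\<close>

type_synonym ('a, 'e) chart = "'a set \<times> ('a \<Rightarrow> 'e)"

abbreviation chart_dom :: "('a, 'e) chart \<Rightarrow> 'a set" where
  "chart_dom c \<equiv> fst c"

abbreviation chart_map :: "('a, 'e) chart \<Rightarrow> 'a \<Rightarrow> 'e" where
  "chart_map c \<equiv> snd c"

definition chart_img :: "('a, 'e) chart \<Rightarrow> 'e set" where
  "chart_img c = chart_map c ` chart_dom c"

definition chart_inv :: "('a, 'e) chart \<Rightarrow> 'e \<Rightarrow> 'a" where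
  "chart_inv c = inv_into (chart_dom c) (chart_map c)"

definition transition :: "('a, 'e) chart \<Rightarrow> ('a, 'f) chart \<Rightarrow> 'e \<Rightarrow> 'f" where
  "transition c d = chart_map d \<circ> chart_inv c"

definition is_chart :: "'a topology \<Rightarrow> ('a, 'e::real_normed_vector) chart \<Rightarrow> bool" where
  "is_chart M c \<longleftrightarrow>
     openin M (chart_dom c) \<and> open (chart_img c) \<and>
     homeomorphic_map (subtopology M (chart_dom c)) (top_of_set (chart_img c)) (chart_map c)"

definition compatible :: "('a, 'e::real_normed_vector) chart \<Rightarrow> ('a, 'e) chart \<Rightarrow> bool" where
  "compatible c d \<longleftrightarrow>
     smooth_on (chart_map c ` (chart_dom c \<inter> chart_dom d)) (transition c d) \<and>
     smooth_on (chart_map d ` (chart_dom c \<inter> chart_dom d)) (transition d c)"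

text \<open>A smooth manifold, its smooth structure given by a maximal atlas, so that \<open>A\<close> consists
  of all local coordinate systems.\<close>

definition smooth_manifold :: "'a topology \<Rightarrow> ('a, 'e::real_normed_vector) chart set \<Rightarrow> bool" where
  "smooth_manifold M A \<longleftrightarrow>
     Hausdorff_space M \<and> second_countable M \<and>
     (\<forall>c\<in>A. is_chart M c) \<and> (\<Union>c\<in>A. chart_dom c) = topspace M \<and>
     (\<forall>c\<in>A. \<forall>d\<in>A. compatible c d) \<and>
     (\<forall>c. is_chart M c \<and> (\<forall>d\<in>A. compatible c d) \<longrightarrow> c \<in> A)"

definition smooth_function :: "('a, 'e::real_normed_vector) chart set \<Rightarrow> ('a \<Rightarrow> real) \<Rightarrow> bool" where
  "smooth_function A f \<longleftrightarrow> (\<forall>c\<in>A. smooth_on (chart_img c) (f \<circ> chart_inv c))"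

text \<open>A tangent vector at \<open>p\<close> is the family of its components in all charts around \<open>p\<close>, which
  transform by the Jacobians of the coordinate changes. The value 0 at all other charts makes the
  representation unique.\<close>

type_synonym ('a, 'e) tvec = "('a, 'e) chart \<Rightarrow> 'e"

definition tangent_space ::
    "('a, 'e::real_normed_vector) chart set \<Rightarrow> 'a \<Rightarrow> ('a, 'e) tvec set" where
  "tangent_space A p =
     {v. (\<forall>c. c \<notin> A \<or> p \<notin> chart_dom c \<longrightarrow> v c = 0) \<and>
         (\<forall>c\<in>A. \<forall>d\<in>A. p \<in> chart_dom c \<inter> chart_dom d \<longrightarrow>
            v d = frechet_derivative (transition c d) (at (chart_map c p)) (v c))}"

definition slit_tangent_bundle ::
    "('a, 'e::real_normed_vector) chart set \<Rightarrow> ('a \<times> ('a, 'e) tvec) set" where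
  "slit_tangent_bundle A =
     {(p, v). p \<in> (\<Union>c\<in>A. chart_dom c) \<and> v \<in> tangent_space A p \<and> v \<noteq> (\<lambda>_. 0)}"

text \<open>The chart \<open>(x\<^sup>i, y\<^sup>i)\<close> of the slit tangent bundle induced by the chart \<open>c = (x\<^sup>i)\<close>.\<close>

definition induced_chart ::
    "('a, 'e::real_normed_vector) chart set \<Rightarrow> ('a, 'e) chart \<Rightarrow>
     ('a \<times> ('a, 'e) tvec, 'e \<times> 'e) chart" where
  "induced_chart A c =
     ({w \<in> slit_tangent_bundle A. fst w \<in> chart_dom c}, \<lambda>w. (chart_map c (fst w), snd w c))"

lemma smooth_on_differentiable:
  assumes "smooth_on S f" "x \<in> S" shows "f differentiable (at x)"
proof -
  have "Ck_on (Suc 0) f S" using assms unfolding smooth_on_def by blast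
  then show ?thesis using assms by simp
qed

lemma chart_inv_map:
  assumes "is_chart M c" "p \<in> chart_dom c" shows "chart_inv c (chart_map c p) = p"
proof -
  have "chart_dom c \<subseteq> topspace M" using assms unfolding is_chart_def by (meson openin_subset)
  then have "inj_on (chart_map c) (chart_dom c)"
    using assms unfolding is_chart_def homeomorphic_map_def by (auto simp: Int_absorb1 Int_absorb2)
  then show ?thesis using assms by (simp add: chart_inv_def)
qed

lemma open_chart_image:
  assumes "is_chart M c" "openin M W" "W \<subseteq> chart_dom c" shows "open (chart_map c ` W)"
proof -
  have "openin (subtopology M (chart_dom c)) W" using assms
    by (metis openin_open_subtopology is_chart_def)
  then have "openin (top_of_set (chart_img c)) (chart_map c ` W)" 
    using assms(1) unfolding is_chart_def
    by (meson homeomorphic_imp_open_map open_map_def)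
  then show ?thesis using assms(1) unfolding is_chart_def
    using openin_open_trans by blast
qed

text \<open>The induced coordinates range over all \<open>(x, y)\<close> with \<open>x\<close> in the image of \<open>c\<close> and \<open>y \<noteq> 0\<close>.\<close>

lemma induced_chart_img:
  fixes A :: "('a, 'e::real_normed_vector) chart set"
  assumes "smooth_manifold M A" "c \<in> A"
  shows "chart_img (induced_chart A c) = chart_img c \<times> (- {0})"
proof -
  have ch: "\<And>d. d\<in>A \<Longrightarrow> is_chart M d" and co: "\<And>d e. d\<in>A \<Longrightarrow> e\<in>A \<Longrightarrow> compatible d e"
    using assms unfolding smooth_manifold_def by blast+
  have civ: "chart_inv d (chart_map d p) = p" if "d\<in>A" "p\<in>chart_dom d" for d p
    by (rule chart_inv_map[OF ch[OF that(1)] that(2)])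
  have diff: "transition d e differentiable (at (chart_map d p))"
    if "d\<in>A" "e\<in>A" "p \<in> chart_dom d" "p\<in>chart_dom e" for d e p
    using co[OF that(1,2)] that smooth_on_differentiable unfolding compatible_def by blast
  let ?J = "\<lambda>p d e. frechet_derivative (transition d e) (at (chart_map d p))"
  have hd: "(transition d e has_derivative ?J p d e) (at (chart_map d p))"
    if "d\<in>A" "e\<in>A" "p \<in> chart_dom d" "p\<in>chart_dom e" for d e p
    using diff[OF that] frechet_derivative_works by blast
  have cocyc: "?J p c e y = ?J p d e (?J p c d y)"
    if "d\<in>A" "e\<in>A" "p \<in> chart_dom c" "p \<in> chart_dom d" "p\<in>chart_dom e" for d e p y
  proof -
    let ?W = "chart_dom c \<inter> chart_dom d \<inter> chart_dom e"
    have oW: "openin M ?W" using ch assms that unfolding is_chart_def by blast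
    have op: "open (chart_map c ` ?W)" by (rule open_chart_image[OF ch[OF assms(2)] oW]) auto
    have tp: "transition c d (chart_map c p) = chart_map d p"
      by (simp add: transition_def chart_inv_map[OF ch[OF assms(2)] that(3)])
    have "((transition d e \<circ> transition c d) has_derivative (?J p d e \<circ> ?J p c d)) (at (chart_map c p))"
      by (rule diff_chain_at) (use hd that assms tp in auto)
    then have "(transition c e has_derivative (?J p d e \<circ> ?J p c d)) (at (chart_map c p))"
    proof (rule has_derivative_transform_within_open[OF _ op])
      show "chart_map c p \<in> chart_map c ` ?W" using that by blast
      fix x assume "x \<in> chart_map c ` ?W"
      then obtain q where q: "q\<in>?W" "x = chart_map c q" by blast
      then show "(transition d e \<circ> transition c d) x = transition c e x"
        using q civ[OF assms(2), of q] civ[OF that(1), of q] by (simp add: transition_def)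
    qed
    then have "?J p c e = ?J p d e \<circ> ?J p c d" by (rule frechet_derivative_at[symmetric])
    then show ?thesis by simp
  qed
  have idc: "?J p c c y = y" if "p \<in> chart_dom c" for p y
  proof -
    have op: "open (chart_img c)" using ch assms unfolding is_chart_def by blast
    have "(transition c c has_derivative (\<lambda>x. x)) (at (chart_map c p))"
    proof (rule has_derivative_transform_within_open[OF _ op])
      show "((\<lambda>x. x) has_derivative (\<lambda>x. x)) (at (chart_map c p))" by simp
      show "chart_map c p \<in> chart_img c" using that by (auto simp: chart_img_def)
      fix x assume "x \<in> chart_img c"
      then show "x = transition c c x"
        using civ[OF assms(2)] by (auto simp: transition_def chart_img_def)
    qed
    then have "?J p c c = (\<lambda>x. x)" by (rule frechet_derivative_at[symmetric])
    then show ?thesis by simp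
  qed
  show ?thesis
  proof (intro set_eqI iffI)
    fix z :: "'e \<times> 'e" assume "z \<in> chart_img (induced_chart A c)"
    then obtain p v where z: "z = (chart_map c p, v c)" "p \<in> chart_dom c" "v \<in> tangent_space A p" "v \<noteq> (\<lambda>_. 0)"
      by (auto simp: chart_img_def induced_chart_def slit_tangent_bundle_def)
    have "v c \<noteq> 0"
    proof
      assume v0: "v c = 0"
      have t0: "v d = 0" if "d \<notin> A \<or> p \<notin> chart_dom d" for d
        using z(3) that unfolding tangent_space_def by blast
      have tJ: "v d = ?J p c d (v c)" if "d \<in> A" "p \<in> chart_dom d" for d
        using z(2,3) assms(2) that unfolding tangent_space_def by blast
      have "v d = 0" for d
      proof (cases "d \<in> A \<and> p \<in> chart_dom d")
        case True
        then have "v d = ?J p c d (v c)" using tJ by blast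
        moreover have "linear (?J p c d)"
          using hd[OF assms(2)] True z(2) has_derivative_linear by blast
        ultimately show ?thesis using v0 linear_0 by simp
      qed (use t0 in blast)
      then show False using z by blast
    qed
    then show "z \<in> chart_img c \<times> (- {0})" using z by (auto simp: chart_img_def)
  next
    fix z :: "'e \<times> 'e" assume "z \<in> chart_img c \<times> (- {0})"
    then obtain p y where z: "z = (chart_map c p, y)" "p \<in> chart_dom c" "y \<noteq> 0" by (auto simp: chart_img_def)
    define v where "v = (\<lambda>d. if d \<in> A \<and> p \<in> chart_dom d then ?J p c d y else 0)"
    have vc: "v c = y" using z assms idc by (simp add: v_def)
    have "v d = ?J p e d (v e)" if "e \<in> A" "d \<in> A" "p \<in> chart_dom e \<inter> chart_dom d" for d e
    proof -
      have "v d = ?J p c d y" "v e = ?J p c e y" using that by (simp_all add: v_def)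
      then show ?thesis using cocyc[OF that(1,2) z(2), of y] that(3) by simp
    qed
    moreover have "v d = 0" if "d \<notin> A \<or> p \<notin> chart_dom d" for d
      using that by (auto simp: v_def)
    ultimately have "v \<in> tangent_space A p" unfolding tangent_space_def by blast
    then have "(p, v) \<in> slit_tangent_bundle A" using z vc assms by (auto simp: slit_tangent_bundle_def)
    then show "z \<in> chart_img (induced_chart A c)" using z vc
      by (force simp: chart_img_def induced_chart_def image_iff)
  qed
qed

definition slit_atlas ::
    "('a, 'e::real_normed_vector) chart set \<Rightarrow> ('a \<times> ('a, 'e) tvec, 'e \<times> 'e) chart set" where
  "slit_atlas A = induced_chart A ` A"

definition field_coords ::
    "('a \<Rightarrow> ('a, 'e) tvec) \<Rightarrow> ('a, 'e) chart \<Rightarrow> 'e \<Rightarrow> 'e" where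
  "field_coords V c x = V (chart_inv c x) c"

definition smooth_vector_field ::
    "('a, 'e::real_normed_vector) chart set \<Rightarrow> ('a \<Rightarrow> ('a, 'e) tvec) \<Rightarrow> bool" where
  "smooth_vector_field A V \<longleftrightarrow>
     (\<forall>p \<in> (\<Union>c\<in>A. chart_dom c). V p \<in> tangent_space A p) \<and>
     (\<forall>c\<in>A. smooth_on (chart_img c) (field_coords V c))"

text \<open>No orientation is assumed and the local density \<open>\<sigma>\<close> is positive in every coordinate system,
  so a volume form transforms by the absolute value of the Jacobian determinant.\<close>

definition volume_form ::
    "('a, real^'n::finite) chart set \<Rightarrow> (('a, real^'n) chart \<Rightarrow> real^'n \<Rightarrow> real) \<Rightarrow> bool" where
  "volume_form A \<sigma> \<longleftrightarrow>
     (\<forall>c\<in>A. smooth_on (chart_img c) (\<sigma> c) \<and> (\<forall>x\<in>chart_img c. 0 < \<sigma> c x)) \<and>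
     (\<forall>c\<in>A. \<forall>d\<in>A. \<forall>p \<in> chart_dom c \<inter> chart_dom d.
        \<sigma> c (chart_map c p) =
          \<bar>det (matrix (frechet_derivative (transition c d) (at (chart_map c p))))\<bar> *
          \<sigma> d (chart_map d p))"


subsection \<open>Sprays\<close>

type_synonym ('a, 'n) slit_field =
  "'a \<times> ('a, real^'n) tvec \<Rightarrow> ('a \<times> ('a, real^'n) tvec, (real^'n) \<times> (real^'n)) tvec"

text \<open>The coefficients \<open>G\<^sup>i(x, y)\<close> in the coordinate system \<open>c\<close>: the vertical components of the
  vector field are \<open>-2 G\<^sup>i\<close>.\<close>

definition spray_coeffs ::
    "('a, real^'n::finite) chart set \<Rightarrow> ('a, 'n) slit_field \<Rightarrow> ('a, real^'n) chart \<Rightarrow>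
     real^'n \<Rightarrow> real^'n \<Rightarrow> real^'n" where
  "spray_coeffs A G c x y = - (1/2) *\<^sub>R snd (field_coords G (induced_chart A c) (x, y))"

definition is_spray ::
    "('a, real^'n::finite) chart set \<Rightarrow> ('a, 'n) slit_field \<Rightarrow> bool" where
  "is_spray A G \<longleftrightarrow>
     smooth_vector_field (slit_atlas A) G \<and>
     (\<forall>c\<in>A. \<forall>(x, y) \<in> chart_img (induced_chart A c).
        fst (field_coords G (induced_chart A c) (x, y)) = y \<and>
        (\<forall>t>0. spray_coeffs A G c x (t *\<^sub>R y) = t\<^sup>2 *\<^sub>R spray_coeffs A G c x y))"


subsection \<open>Curvatures in local coordinates\<close>

text \<open>Functions on the slit tangent bundle are given by their expressions \<open>\<Phi> x y\<close> in the induced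
  coordinates; here \<open>H\<close> stands for the coefficients of a spray and \<open>s\<close> for the density
  of a volume form in a fixed coordinate system.\<close>

definition Riemann_curv ::
    "(real^'n::finite \<Rightarrow> real^'n \<Rightarrow> real^'n) \<Rightarrow> 'n \<Rightarrow> 'n \<Rightarrow> real^'n \<Rightarrow> real^'n \<Rightarrow> real" where
  "Riemann_curv H i k x y =
     2 * partial k (\<lambda>x. H x y $ i) x
     - (\<Sum>j\<in>UNIV. y $ j * partial j (\<lambda>x. partial k (\<lambda>y. H x y $ i) y) x)
     + 2 * (\<Sum>j\<in>UNIV. H x y $ j * partial j (\<lambda>y. partial k (\<lambda>y. H x y $ i) y) y)
     - (\<Sum>s\<in>UNIV. partial s (\<lambda>y. H x y $ i) y * partial k (\<lambda>y. H x y $ s) y)"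

definition Ricci_curv ::
    "(real^'n::finite \<Rightarrow> real^'n \<Rightarrow> real^'n) \<Rightarrow> real^'n \<Rightarrow> real^'n \<Rightarrow> real" where
  "Ricci_curv H x y = (\<Sum>m\<in>UNIV. Riemann_curv H m m x y)"

definition S_curv ::
    "(real^'n::finite \<Rightarrow> real^'n \<Rightarrow> real^'n) \<Rightarrow> (real^'n \<Rightarrow> real) \<Rightarrow> real^'n \<Rightarrow> real^'n \<Rightarrow> real" where
  "S_curv H s x y =
     (\<Sum>m\<in>UNIV. partial m (\<lambda>y. H x y $ m) y) -
     (\<Sum>m\<in>UNIV. y $ m * partial m (\<lambda>x. ln (s x)) x)"

definition proj_spray_coeffs ::
    "(real^'n::finite \<Rightarrow> real^'n \<Rightarrow> real^'n) \<Rightarrow> (real^'n \<Rightarrow> real) \<Rightarrow> real^'n \<Rightarrow> real^'n \<Rightarrow> real^'n" where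
  "proj_spray_coeffs H s x y = H x y - (S_curv H s x y / (real CARD('n) + 1)) *\<^sub>R y"

definition PRic_curv ::
    "(real^'n::finite \<Rightarrow> real^'n \<Rightarrow> real^'n) \<Rightarrow> (real^'n \<Rightarrow> real) \<Rightarrow> real^'n \<Rightarrow> real^'n \<Rightarrow> real" where
  "PRic_curv H s = Ricci_curv (proj_spray_coeffs H s)"

text \<open>\<open>\<Phi>\<^bsub>|0\<^esub> = G(\<Phi>)\<close>\<close>

definition horiz_deriv ::
    "(real^'n::finite \<Rightarrow> real^'n \<Rightarrow> real^'n) \<Rightarrow> (real^'n \<Rightarrow> real^'n \<Rightarrow> real) \<Rightarrow>
     real^'n \<Rightarrow> real^'n \<Rightarrow> real" where
  "horiz_deriv H \<Phi> x y =
     (\<Sum>m\<in>UNIV. y $ m * partial m (\<lambda>x. \<Phi> x y) x) -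
     2 * (\<Sum>m\<in>UNIV. H x y $ m * partial m (\<lambda>y. \<Phi> x y) y)"

definition d0 :: "(real^'n::finite \<Rightarrow> real) \<Rightarrow> real^'n \<Rightarrow> real^'n \<Rightarrow> real" where
  "d0 h x y = (\<Sum>m\<in>UNIV. partial m h x * y $ m)"

definition Xi ::
    "(real^'n::finite \<Rightarrow> real^'n \<Rightarrow> real^'n) \<Rightarrow> (real^'n \<Rightarrow> real) \<Rightarrow> (real^'n \<Rightarrow> real) \<Rightarrow>
     real^'n \<Rightarrow> real^'n \<Rightarrow> real" where
  "Xi H s h x y = S_curv H s x y / (real CARD('n) + 1) - d0 h x y"

definition projectively_Ricci_flat ::
    "('a, real^'n::finite) chart set \<Rightarrow> ('a, 'n) slit_field \<Rightarrow> bool" where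
  "projectively_Ricci_flat A G \<longleftrightarrow>
     (\<exists>\<sigma>. volume_form A \<sigma> \<and>
        (\<forall>c\<in>A. \<forall>(x, y) \<in> chart_img (induced_chart A c).
           PRic_curv (spray_coeffs A G c) (\<sigma> c) x y = 0))"

end

theory Submission
  imports Defs
begin

text \<open>Both sides of the equivalence state the same equation, for two different volume forms.
  Fix a coordinate system, and let \<open>P = S / (n + 1)\<close>, so that the projective spray has the coefficients
  \<open>G + Q y\<close> with \<open>Q = - P\<close>. The Ricci curvature of a spray is

    \<open>Ric = 2 \<partial>G\<^sup>m/\<partial>x\<^sup>m - N\<^bsub>|0\<^esub> - tr ((\<partial>G/\<partial>y)\<^sup>2)\<close>, where \<open>N = \<partial>G\<^sup>m/\<partial>y\<^sup>m\<close>,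

  and Euler's theorem for the homogeneous functions \<open>G\<close>, \<open>N\<close> and \<open>Q\<close> (of degrees 2, 1 and 1) turns this
  into the transformation law \<open>Ricci_curv_projective_change\<close>: passing from \<open>G\<close> to \<open>G + Q y\<close> adds
  \<open>(n - 1) (Q\<^sup>2 - Q\<^bsub>|0\<^esub>)\<close> to the Ricci curvature. With \<open>Q = - P\<close>,

    \<open>PRic = Ric + (n - 1) (P\<^bsub>|0\<^esub> + P\<^sup>2)\<close>.

  Multiplying the volume form by \<open>exp ((n + 1) f)\<close> subtracts \<open>(n + 1) f\<^sub>0\<close> from the S-curvature
  (\<open>Xi_eq_S_curv_weighted\<close>). Hence \<open>\<Xi>\<close>, formed with \<open>dV\<close> and \<open>f\<close>, is the \<open>P\<close> of the volume form
  \<open>exp ((n + 1) f) dV\<close>, and the equation for \<open>Ric\<close> in the theorem says that \<open>PRic\<close> vanishes for this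
  weighted volume form. From a volume form with \<open>PRic = 0\<close> one therefore gets a solution by taking
  \<open>f = 0\<close>, and conversely a solution \<open>dV\<close>, \<open>f\<close> gives the volume form \<open>exp ((n + 1) f) dV\<close>.\<close>

section \<open>Closure properties of smooth maps\<close>

lemma Ck_on_cong:
  assumes "open S" "\<And>x. x \<in> S \<Longrightarrow> f x = g x" "Ck_on k f S"
  shows "Ck_on k g S"
  using assms(2,3)
proof (induction k arbitrary: f g)
  case 0
  then show ?case using continuous_on_cong by fastforce
next
  case (Suc k)
  have hd: "(g has_derivative frechet_derivative f (at x)) (at x)" if "x \<in> S" for x
  proof (rule has_derivative_transform_within_open[OF _ assms(1) that])
    show "(f has_derivative frechet_derivative f (at x)) (at x)"
      using Suc.prems that frechet_derivative_works by auto
  qed (use Suc.prems in auto)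
  then have "frechet_derivative f (at x) = frechet_derivative g (at x)" if "x \<in> S" for x
    using that frechet_derivative_at by blast
  then have "Ck_on k (\<lambda>x. frechet_derivative g (at x) v) S" for v
    using Suc.IH[of "\<lambda>x. frechet_derivative f (at x) v" "\<lambda>x. frechet_derivative g (at x) v"] Suc.prems
    by auto
  then show ?case using hd by (auto intro: differentiableI)
qed

text \<open>Reduces a closure property at order \<open>k + 1\<close> to an explicit formula for the derivative, valid on
  \<open>S\<close> only, and closure properties at order \<open>k\<close>.\<close>

lemma Ck_on_SucI:
  assumes "open S" "\<And>x. x \<in> S \<Longrightarrow> (f has_derivative f' x) (at x)"
    and "\<And>v. Ck_on k (\<lambda>x. f' x v) S"
  shows "Ck_on (Suc k) f S"
proof -
  have "f' x = frechet_derivative f (at x)" if "x \<in> S" for x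
    using assms(2)[OF that] frechet_derivative_at by blast
  then have "Ck_on k (\<lambda>x. frechet_derivative f (at x) v) S" for v
    by (intro Ck_on_cong[OF assms(1) _ assms(3)]) auto
  then show ?thesis using assms(2) by (auto intro: differentiableI)
qed

lemma Ck_on_SucD:
  assumes "Ck_on (Suc k) f S"
  shows "x \<in> S \<Longrightarrow> (f has_derivative frechet_derivative f (at x)) (at x)"
    and "Ck_on k (\<lambda>x. frechet_derivative f (at x) v) S"
  using assms frechet_derivative_works by auto

lemma Ck_on_decr: "Ck_on (Suc k) f S \<Longrightarrow> Ck_on k f S"
proof (induction k arbitrary: f)
  case 0
  then show ?case
    by (auto intro!: continuous_at_imp_continuous_on differentiable_imp_continuous_within)
next
  case (Suc k)
  then show ?case by (metis Ck_on.simps(2))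
qed

(* From here on, Ck_on_SucI and Ck_on_SucD replace the recursion equation, which would unfold
   every induction goal into Frechet derivatives. *)
declare Ck_on.simps(2) [simp del]

lemma Ck_on_add:
  assumes "open S" "Ck_on k f S" "Ck_on k g S"
  shows "Ck_on k (\<lambda>x. f x + g x) S"
  using assms(2,3)
proof (induction k arbitrary: f g)
  case 0
  then show ?case by (simp add: continuous_on_add)
next
  case (Suc k)
  note D = Suc.prems[THEN Ck_on_SucD(1)] Suc.prems[THEN Ck_on_SucD(2)]
  show ?case
    by (rule Ck_on_SucI[OF assms(1) has_derivative_add[OF D(1,2)] Suc.IH[OF D(3,4)]])
qed

lemma Ck_on_mult:
  fixes f g :: "'e::real_normed_vector \<Rightarrow> 'b::real_normed_algebra"
  assumes "open S" "Ck_on k f S" "Ck_on k g S"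
  shows "Ck_on k (\<lambda>x. f x * g x) S"
  using assms(2,3)
proof (induction k arbitrary: f g)
  case 0
  then show ?case by (simp add: continuous_on_mult)
next
  case (Suc k)
  note D = Suc.prems[THEN Ck_on_SucD(1)] Suc.prems[THEN Ck_on_SucD(2)]
    and C = Suc.prems[THEN Ck_on_decr]
  show ?case
    by (rule Ck_on_SucI[OF assms(1) has_derivative_mult[OF D(1,2)]
          Ck_on_add[OF assms(1) Suc.IH[OF C(1) D(4)] Suc.IH[OF D(3) C(2)]]])
qed

lemma Ck_on_exp:
  fixes f :: "'e::real_normed_vector \<Rightarrow> real"
  assumes "open S" "Ck_on k f S"
  shows "Ck_on k (\<lambda>x. exp (f x)) S"
  using assms(2)
proof (induction k)
  case 0
  then show ?case by (simp add: continuous_on_exp)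
next
  case (Suc k)
  have hd: "((\<lambda>x. exp (f x)) has_derivative
      (\<lambda>v. exp (f x) * frechet_derivative f (at x) v)) (at x)" if "x \<in> S" for x
    using has_derivative_compose[OF Ck_on_SucD(1)[OF Suc.prems that]
        DERIV_exp[of "f x", unfolded has_field_derivative_def]] .
  show ?case
    by (rule Ck_on_SucI[OF assms(1) hd
          Ck_on_mult[OF assms(1) Suc.IH[OF Ck_on_decr[OF Suc.prems]] Ck_on_SucD(2)[OF Suc.prems]]])
qed

lemma Ck_on_bounded_linear:
  assumes "bounded_linear L" "open S" "Ck_on k f S"
  shows "Ck_on k (\<lambda>x. L (f x)) S"
  using assms(3)
proof (induction k arbitrary: f)
  case 0
  then show ?case by (simp add: bounded_linear.continuous_on[OF assms(1)])
next
  case (Suc k)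
  show ?case
    by (rule Ck_on_SucI[OF assms(2) bounded_linear.has_derivative[OF assms(1)
            Ck_on_SucD(1)[OF Suc.prems]] Suc.IH[OF Ck_on_SucD(2)[OF Suc.prems]]])
qed

lemma smooth_on_derivative:
  "smooth_on S f \<Longrightarrow> smooth_on S (\<lambda>x. frechet_derivative f (at x) v)"
  unfolding smooth_on_def using Ck_on_SucD(2) by blast

text \<open>The derivative of \<open>ln f\<close> is \<open>exp (- ln f) Df\<close>; in this form its first factor
  is covered by the induction hypothesis together with closure under \<open>exp\<close>.\<close>

lemma Ck_on_ln:
  fixes f :: "'e::real_normed_vector \<Rightarrow> real"
  assumes "open S" "Ck_on k f S" "\<And>x. x \<in> S \<Longrightarrow> 0 < f x"
  shows "Ck_on k (\<lambda>x. ln (f x)) S"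
  using assms(2)
proof (induction k)
  case 0
  then show ?case using assms(3) by (auto intro!: continuous_on_ln simp: less_imp_neq[symmetric])
next
  case (Suc k)
  have hd: "((\<lambda>x. ln (f x)) has_derivative
      (\<lambda>v. exp (- 1 * ln (f x)) * frechet_derivative f (at x) v)) (at x)" if "x \<in> S" for x
    using has_derivative_compose[OF Ck_on_SucD(1)[OF Suc.prems that]
        DERIV_ln[OF assms(3)[OF that], unfolded has_field_derivative_def]] assms(3)[OF that]
    by (simp add: exp_minus)
  have "Ck_on k (\<lambda>x. ln (f x)) S" using Suc Ck_on_decr by blast
  then have "Ck_on k (\<lambda>x. exp (- 1 * ln (f x))) S"
    using Ck_on_bounded_linear[OF bounded_linear_mult_right assms(1)] by (intro Ck_on_exp assms(1)) blast
  from Ck_on_SucI[OF assms(1) hd Ck_on_mult[OF assms(1) this Ck_on_SucD(2)[OF Suc.prems]]]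
  show ?case .
qed

lemma Ck_on_compose_linear:
  assumes "bounded_linear L" "open S" "L ` S \<subseteq> T" "Ck_on k g T"
  shows "Ck_on k (\<lambda>x. g (L x)) S"
  using assms(4)
proof (induction k arbitrary: g)
  case 0
  have "continuous_on S L" using assms(1) by (simp add: linear_continuous_on)
  with 0 show ?case using continuous_on_compose2 assms(3) by auto
next
  case (Suc k)
  have hd: "((\<lambda>x. g (L x)) has_derivative (\<lambda>v. frechet_derivative g (at (L x)) (L v))) (at x)"
    if "x \<in> S" for x
    by (rule has_derivative_compose[OF bounded_linear_imp_has_derivative[OF assms(1)]])
      (use Suc.prems that assms(3) in \<open>auto intro!: Ck_on_SucD(1)\<close>)
  show ?case
    by (rule Ck_on_SucI[OF assms(2) hd]) (use Suc.IH Ck_on_SucD(2)[OF Suc.prems] in auto)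
qed

lemma smooth_on_const: "smooth_on S (\<lambda>x. c)"
proof -
  have "Ck_on k (\<lambda>x. c) S" for k
    by (induction k arbitrary: c) (auto simp: Ck_on.simps(2) frechet_derivative_const)
  then show ?thesis by (simp add: smooth_on_def)
qed

lemma smooth_on_ident: "smooth_on S (\<lambda>x. x)"
proof -
  have "Ck_on k (\<lambda>x. x) S" for k
    using smooth_on_const[unfolded smooth_on_def]
    by (cases k) (auto simp: Ck_on.simps(2) frechet_derivative_ident)
  then show ?thesis by (simp add: smooth_on_def)
qed

lemma smooth_on_cong:
  "open S \<Longrightarrow> (\<And>x. x \<in> S \<Longrightarrow> f x = g x) \<Longrightarrow> smooth_on S f \<Longrightarrow> smooth_on S g"
  unfolding smooth_on_def using Ck_on_cong by blast

lemma smooth_on_add: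
  "open S \<Longrightarrow> smooth_on S f \<Longrightarrow> smooth_on S g \<Longrightarrow> smooth_on S (\<lambda>x. f x + g x)"
  by (simp add: smooth_on_def Ck_on_add)

lemma smooth_on_mult:
  fixes f g :: "'e::real_normed_vector \<Rightarrow> 'b::real_normed_algebra"
  shows "open S \<Longrightarrow> smooth_on S f \<Longrightarrow> smooth_on S g \<Longrightarrow> smooth_on S (\<lambda>x. f x * g x)"
  by (simp add: smooth_on_def Ck_on_mult)

lemma smooth_on_bounded_linear:
  "bounded_linear L \<Longrightarrow> open S \<Longrightarrow> smooth_on S f \<Longrightarrow> smooth_on S (\<lambda>x. L (f x))"
  by (simp add: smooth_on_def Ck_on_bounded_linear)

lemma smooth_on_linear: "bounded_linear L \<Longrightarrow> open S \<Longrightarrow> smooth_on S L"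
  using smooth_on_bounded_linear smooth_on_ident by blast

lemma smooth_on_compose_linear:
  "bounded_linear L \<Longrightarrow> open S \<Longrightarrow> L ` S \<subseteq> T \<Longrightarrow> smooth_on T g \<Longrightarrow> smooth_on S (\<lambda>x. g (L x))"
  using Ck_on_compose_linear unfolding smooth_on_def by blast

lemma smooth_on_exp:
  fixes f :: "'e::real_normed_vector \<Rightarrow> real"
  shows "open S \<Longrightarrow> smooth_on S f \<Longrightarrow> smooth_on S (\<lambda>x. exp (f x))"
  by (simp add: smooth_on_def Ck_on_exp)

lemma smooth_on_ln:
  fixes f :: "'e::real_normed_vector \<Rightarrow> real"
  shows "open S \<Longrightarrow> (\<And>x. x \<in> S \<Longrightarrow> 0 < f x) \<Longrightarrow> smooth_on S f \<Longrightarrow> smooth_on S (\<lambda>x. ln (f x))"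
  by (simp add: smooth_on_def Ck_on_ln)

lemma smooth_on_sum:
  assumes "open S" "\<And>i. i \<in> I \<Longrightarrow> smooth_on S (f i)"
  shows "smooth_on S (\<lambda>x. \<Sum>i\<in>I. f i x)"
  using assms(2)
  by (induction I rule: infinite_finite_induct) (auto intro!: smooth_on_const smooth_on_add assms(1))

lemma smooth_on_nth:
  fixes f :: "'e::real_normed_vector \<Rightarrow> real^'n::finite"
  shows "open S \<Longrightarrow> smooth_on S f \<Longrightarrow> smooth_on S (\<lambda>x. f x $ i)"
  by (rule smooth_on_bounded_linear[OF bounded_linear_vec_nth])

lemma smooth_on_vec_lambda:
  fixes f :: "'n::finite \<Rightarrow> 'e::real_normed_vector \<Rightarrow> real"
  assumes "open S" "\<And>i. smooth_on S (f i)"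
  shows "smooth_on S (\<lambda>x. \<chi> i. f i x)"
proof -
  have "bounded_linear (\<lambda>r. r *\<^sub>R axis i (1::real) :: real^'n)" for i
    by (rule bounded_linear_scaleR_left)
  then have "smooth_on S (\<lambda>x. \<Sum>i\<in>UNIV. f i x *\<^sub>R axis i 1 :: real^'n)"
    by (intro smooth_on_sum smooth_on_bounded_linear[OF _ assms(1) assms(2)] assms(1))
  then show ?thesis
    using basis_expansion[of "\<chi> i. f i _"] by (simp add: scalar_mult_eq_scaleR)
qed

section \<open>Partial derivatives\<close>

lemma partial_eq: "(h has_derivative D) (at x) \<Longrightarrow> partial k h x = D (axis k 1)"
  by (simp add: partial_def frechet_derivative_at[symmetric])

text \<open>A partial derivative at \<open>x\<close> depends only on the germ of the function at \<open>x\<close>.\<close>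

lemma partial_cong:
  assumes "open S" "x \<in> S" "\<And>x. x \<in> S \<Longrightarrow> f x = g x"
  shows "partial k f x = partial k g x"
proof -
  have "(f has_derivative D) (at x) \<longleftrightarrow> (g has_derivative D) (at x)" for D
    using has_derivative_transform_within_open[OF _ assms(1,2)] assms(3) by metis
  then show ?thesis by (simp add: partial_def frechet_derivative_def)
qed

lemma partial_add:
  assumes "f differentiable (at x)" "g differentiable (at x)"
  shows "partial k (\<lambda>x. f x + g x) x = partial k f x + partial k g x"
  using partial_eq[OF has_derivative_add[OF assms[unfolded frechet_derivative_works]]]
  by (simp add: partial_def)

lemma partial_mult:
  assumes "f differentiable (at x)" "g differentiable (at x)"
  shows "partial k (\<lambda>x. f x * g x) x = f x * partial k g x + partial k f x * g x"
  using partial_eq[OF has_derivative_mult[OF assms[unfolded frechet_derivative_works]]]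
  by (simp add: partial_def)

lemma partial_const: "partial k (\<lambda>x. c) x = 0"
  by (simp add: partial_eq[OF has_derivative_const])

lemma partial_cmult:
  "f differentiable (at x) \<Longrightarrow> partial k (\<lambda>x. c * f x) x = c * partial k f x"
  by (simp add: partial_mult partial_const)

lemma partial_sum:
  assumes "\<And>i. i \<in> I \<Longrightarrow> f i differentiable (at x)"
  shows "partial k (\<lambda>x. \<Sum>i\<in>I. f i x) x = (\<Sum>i\<in>I. partial k (f i) x)"
proof -
  have "((\<lambda>x. \<Sum>i\<in>I. f i x) has_derivative (\<lambda>v. \<Sum>i\<in>I. frechet_derivative (f i) (at x) v)) (at x)"
    using assms by (intro has_derivative_sum) (simp add: frechet_derivative_works)
  from partial_eq[OF this] show ?thesis by (simp add: partial_def)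
qed

lemma partial_component: "partial k (\<lambda>x. x $ i) x = (if k = i then 1 else 0)"
proof -
  have "((\<lambda>x. x $ i) has_derivative (\<lambda>x. x $ i)) (at x)"
    using bounded_linear_imp_has_derivative bounded_linear_vec_nth by blast
  then show ?thesis by (simp add: partial_eq axis_def)
qed

lemma partial_ln:
  assumes "s differentiable (at x)" "0 < s x"
  shows "partial k (\<lambda>x. ln (s x)) x = partial k s x / s x"
proof -
  have "((\<lambda>x. ln (s x)) has_derivative (\<lambda>v. inverse (s x) * frechet_derivative s (at x) v)) (at x)"
    using has_derivative_compose[OF assms(1)[unfolded frechet_derivative_works]
        DERIV_ln[OF assms(2), unfolded has_field_derivative_def]] .
  from partial_eq[OF this] show ?thesis by (simp add: partial_def field_simps)
qed

lemma sum_partial: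
  fixes h :: "real^'n::finite \<Rightarrow> real"
  assumes "(h has_derivative D) (at x)"
  shows "(\<Sum>m\<in>UNIV. v $ m * partial m h x) = D v"
proof -
  interpret linear D using assms has_derivative_linear by blast
  have "D v = D (\<Sum>m\<in>UNIV. v $ m *\<^sub>R axis m 1)"
    using basis_expansion[of v] by (simp add: scalar_mult_eq_scaleR)
  also have "\<dots> = (\<Sum>m\<in>UNIV. v $ m * partial m h x)"
    by (simp add: sum scaleR partial_eq[OF assms])
  finally show ?thesis by simp
qed

text \<open>Euler's theorem: differentiate both sides of the homogeneity condition with respect to \<open>t\<close> at
  \<open>t = 1\<close>.\<close>

lemma Euler_homogeneous:
  fixes h :: "real^'n::finite \<Rightarrow> real"
  assumes "h differentiable (at y)" "\<And>t. 0 < t \<Longrightarrow> h (t *\<^sub>R y) = t ^ k * h y"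
  shows "(\<Sum>m\<in>UNIV. y $ m * partial m h y) = k * h y"
proof -
  obtain D where D: "(h has_derivative D) (at y)" using assms(1) differentiable_def by blast
  have 1: "((\<lambda>t. t *\<^sub>R y) has_derivative (\<lambda>t. t *\<^sub>R y)) (at (1::real))"
    by (auto intro!: derivative_eq_intros)
  have "((\<lambda>t. h (t *\<^sub>R y)) has_derivative (\<lambda>t. D (t *\<^sub>R y))) (at (1::real))"
    by (rule has_derivative_compose[OF 1]) (use D in simp)
  moreover have "((\<lambda>t. h (t *\<^sub>R y)) has_derivative (\<lambda>t. t * (k * h y))) (at (1::real))"
  proof (rule has_derivative_transform_within_open[of _ _ _ _ "{0<..}"])
    show "((\<lambda>t. t ^ k * h y) has_derivative (\<lambda>t. t * (k * h y))) (at (1::real))"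
      by (auto intro!: derivative_eq_intros)
  qed (use assms(2) in auto)
  ultimately have "(\<lambda>t. D (t *\<^sub>R y)) = (\<lambda>t. t * (k * h y))"
    by (rule has_derivative_unique)
  then have "D y = k * h y" by (metis mult_1 scaleR_one)
  then show ?thesis using sum_partial[OF D] by simp
qed

text \<open>Here the homogeneity condition is differentiated with respect to \<open>y\<close>, which produces a factor
  \<open>t\<close> on the left.\<close>

lemma partial_homogeneous:
  fixes h :: "real^'n::finite \<Rightarrow> real"
  assumes "\<And>y. y \<noteq> 0 \<Longrightarrow> h differentiable (at y)"
    and hom: "\<And>y. y \<noteq> 0 \<Longrightarrow> h (t *\<^sub>R y) = t ^ Suc k * h y"
    and "0 < t" "y \<noteq> 0"
  shows "partial m h (t *\<^sub>R y) = t ^ k * partial m h y"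
proof -
  let ?D = "frechet_derivative h (at (t *\<^sub>R y))"
  have D: "(h has_derivative ?D) (at (t *\<^sub>R y))"
    using assms by (simp add: frechet_derivative_works[symmetric])
  then interpret linear ?D using has_derivative_linear by blast
  have 1: "((\<lambda>y. t *\<^sub>R y) has_derivative (\<lambda>v. t *\<^sub>R v)) (at y)"
    by (auto intro!: derivative_eq_intros)
  have "partial m (\<lambda>y. h (t *\<^sub>R y)) y = t * partial m h (t *\<^sub>R y)"
    using partial_eq[OF has_derivative_compose[OF 1 D]] by (simp add: scaleR partial_def)
  moreover have "partial m (\<lambda>y. h (t *\<^sub>R y)) y = partial m (\<lambda>y. t ^ Suc k * h y) y"
    by (rule partial_cong[of "- {0}"]) (use assms in auto)
  ultimately show ?thesis using assms by (simp add: partial_cmult)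
qed

section \<open>Functions of position and direction\<close>

text \<open>The curvatures are built from separate partial derivatives in \<open>x\<close> and in \<open>y\<close>, whereas smoothness
  of a spray is joint smoothness in \<open>(x, y)\<close>. The following lemmas relate the two: the partial
  derivatives are values of the joint derivative at \<open>(v, 0)\<close> and \<open>(0, v)\<close>, so they are again jointly
  smooth.\<close>

lemma open_slit:
  fixes U :: "'e::topological_space set"
  shows "open U \<Longrightarrow> open (U \<times> (- {0 :: 'f::real_normed_vector}))"
  by (intro open_Times) (auto simp: open_Compl)

lemma slice_derivative:
  assumes "(\<lambda>z. F (fst z) (snd z)) differentiable (at (x, y))"
  shows "(F x has_derivative (\<lambda>v. frechet_derivative (\<lambda>z. F (fst z) (snd z)) (at (x, y)) (0, v))) (at y)"
    and "((\<lambda>x. F x y) has_derivative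
           (\<lambda>v. frechet_derivative (\<lambda>z. F (fst z) (snd z)) (at (x, y)) (v, 0))) (at x)"
proof -
  let ?F = "\<lambda>z. F (fst z) (snd z)"
  have D: "(?F has_derivative frechet_derivative ?F (at (x, y))) (at (x, y))"
    using assms frechet_derivative_works by blast
  have "(Pair x has_derivative (\<lambda>v. (0, v))) (at y)"
    by (auto intro!: derivative_eq_intros)
  from has_derivative_compose[OF this D]
  show "(F x has_derivative (\<lambda>v. frechet_derivative ?F (at (x, y)) (0, v))) (at y)" by simp
  have "((\<lambda>x. (x, y)) has_derivative (\<lambda>v. (v, 0))) (at x)"
    by (auto intro!: derivative_eq_intros)
  from has_derivative_compose[OF this D]
  show "((\<lambda>x. F x y) has_derivative (\<lambda>v. frechet_derivative ?F (at (x, y)) (v, 0))) (at x)" by simp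
qed

lemma slice_differentiable:
  assumes "smooth_on W (\<lambda>z. F (fst z) (snd z))" "(x, y) \<in> W"
  shows "F x differentiable (at y)" "(\<lambda>x. F x y) differentiable (at x)"
  using slice_derivative[OF smooth_on_differentiable[OF assms]] unfolding differentiable_def by blast+

lemma smooth_on_vertical_partial:
  assumes "open W" "smooth_on W (\<lambda>z. F (fst z) (snd z))"
  shows "smooth_on W (\<lambda>z. partial m (F (fst z)) (snd z))"
proof (rule smooth_on_cong[OF assms(1) _ smooth_on_derivative[OF assms(2)]])
  fix z assume "z \<in> W"
  then have "(\<lambda>z. F (fst z) (snd z)) differentiable (at (fst z, snd z))"
    using smooth_on_differentiable[OF assms(2)] by simp
  from partial_eq[OF slice_derivative(1)[OF this]]
  show "frechet_derivative (\<lambda>z. F (fst z) (snd z)) (at z) (0, axis m 1) = partial m (F (fst z)) (snd z)"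
    by simp
qed

definition vertical_div :: "(real^'n::finite \<Rightarrow> real^'n \<Rightarrow> real^'n) \<Rightarrow> real^'n \<Rightarrow> real^'n \<Rightarrow> real" where
  "vertical_div H x y = (\<Sum>m\<in>UNIV. partial m (\<lambda>y. H x y $ m) y)"

lemma smooth_on_vertical_div:
  assumes "open W" "smooth_on W (\<lambda>z. H (fst z) (snd z))"
  shows "smooth_on W (\<lambda>z. vertical_div H (fst z) (snd z))"
  unfolding vertical_div_def
  by (intro smooth_on_sum assms(1) smooth_on_vertical_partial smooth_on_nth assms(2))

lemma vertical_div_homogeneous:
  fixes H :: "real^'n::finite \<Rightarrow> real^'n \<Rightarrow> real^'n"
  assumes "open U" and H: "smooth_on (U \<times> - {0}) (\<lambda>z. H (fst z) (snd z))"
    and H_hom: "\<And>x y t. x \<in> U \<Longrightarrow> y \<noteq> 0 \<Longrightarrow> 0 < t \<Longrightarrow> H x (t *\<^sub>R y) = t\<^sup>2 *\<^sub>R H x y"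
    and "x \<in> U" "y \<noteq> 0" "0 < t"
  shows "vertical_div H x (t *\<^sub>R y) = t * vertical_div H x y"
proof -
  have W: "open (U \<times> (- {0} :: (real^'n) set))" by (rule open_slit[OF assms(1)])
  have "partial m (\<lambda>y. H x y $ m) (t *\<^sub>R y) = t ^ 1 * partial m (\<lambda>y. H x y $ m) y" for m
    by (rule partial_homogeneous)
      (use slice_differentiable(1)[OF smooth_on_nth[OF W H]] assms in \<open>auto simp: power2_eq_square\<close>)
  then show ?thesis by (simp add: vertical_div_def sum_distrib_left)
qed

lemma horiz_deriv_cong:
  assumes "open U" "open V" "x \<in> U" "y \<in> V"
    and "\<And>x y. x \<in> U \<Longrightarrow> y \<in> V \<Longrightarrow> \<Phi> x y = \<Psi> x y"
  shows "horiz_deriv H \<Phi> x y = horiz_deriv H \<Psi> x y"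
proof -
  have "partial m (\<lambda>x. \<Phi> x y) x = partial m (\<lambda>x. \<Psi> x y) x" for m
    by (rule partial_cong[OF assms(1,3)]) (use assms in auto)
  moreover have "partial m (\<lambda>y. \<Phi> x y) y = partial m (\<lambda>y. \<Psi> x y) y" for m
    by (rule partial_cong[OF assms(2,4)]) (use assms in auto)
  ultimately show ?thesis by (simp add: horiz_deriv_def)
qed

lemma horiz_deriv_add_cmult:
  assumes "smooth_on W (\<lambda>z. \<Phi> (fst z) (snd z))" "smooth_on W (\<lambda>z. \<Psi> (fst z) (snd z))"
    and "(x, y) \<in> W"
  shows "horiz_deriv H (\<lambda>x y. \<Phi> x y + c * \<Psi> x y) x y = horiz_deriv H \<Phi> x y + c * horiz_deriv H \<Psi> x y"
proof -
  note d = slice_differentiable[OF assms(1,3)] slice_differentiable[OF assms(2,3)]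
  have "partial m (\<lambda>x. \<Phi> x y + c * \<Psi> x y) x = partial m (\<lambda>x. \<Phi> x y) x + c * partial m (\<lambda>x. \<Psi> x y) x"
    "partial m (\<lambda>y. \<Phi> x y + c * \<Psi> x y) y = partial m (\<Phi> x) y + c * partial m (\<Psi> x) y" for m
    using d by (simp_all add: partial_add partial_cmult)
  then show ?thesis
    by (simp add: horiz_deriv_def algebra_simps sum.distrib sum_distrib_left)
qed

text \<open>By Euler's theorem the sum on the right is \<open>k \<Phi>\<close> when \<open>\<Phi>\<close> is homogeneous of degree \<open>k\<close> in \<open>y\<close>.\<close>

lemma horiz_deriv_change_spray:
  "horiz_deriv (\<lambda>x y. H x y + Q x y *\<^sub>R y) \<Phi> x y =
     horiz_deriv H \<Phi> x y - 2 * Q x y * (\<Sum>m\<in>UNIV. y $ m * partial m (\<Phi> x) y)"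
  by (simp add: horiz_deriv_def algebra_simps sum.distrib sum_distrib_left)

section \<open>Ricci curvature under a projective change\<close>

text \<open>Taking the trace of the Riemann curvature, the two terms with second derivatives combine to the
  horizontal derivative of the vertical divergence, since differentiation commutes with the finite
  sum over \<open>m\<close>.\<close>

lemma Ricci_curv_eq:
  assumes "open W" "smooth_on W (\<lambda>z. H (fst z) (snd z))" "(x, y) \<in> W"
  shows "Ricci_curv H x y =
     2 * (\<Sum>m\<in>UNIV. partial m (\<lambda>x. H x y $ m) x)
     - horiz_deriv H (vertical_div H) x y
     - (\<Sum>m\<in>UNIV. \<Sum>s\<in>UNIV. partial s (\<lambda>y. H x y $ m) y * partial m (\<lambda>y. H x y $ s) y)"
proof -
  have sm: "smooth_on W (\<lambda>z. partial m (\<lambda>y. H (fst z) y $ m) (snd z))" for m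
    by (rule smooth_on_vertical_partial[OF assms(1) smooth_on_nth[OF assms(1,2)]])
  have px: "partial j (\<lambda>x. vertical_div H x y) x =
      (\<Sum>m\<in>UNIV. partial j (\<lambda>x. partial m (\<lambda>y. H x y $ m) y) x)" for j
    unfolding vertical_div_def by (rule partial_sum) (rule slice_differentiable(2)[OF sm assms(3)])
  have py: "partial j (vertical_div H x) y =
      (\<Sum>m\<in>UNIV. partial j (\<lambda>y. partial m (\<lambda>y. H x y $ m) y) y)" for j
    unfolding vertical_div_def by (rule partial_sum) (rule slice_differentiable(1)[OF sm assms(3)])
  have "(\<Sum>m\<in>UNIV. \<Sum>j\<in>UNIV. y $ j * partial j (\<lambda>x. partial m (\<lambda>y. H x y $ m) y) x)
      = (\<Sum>j\<in>UNIV. y $ j * partial j (\<lambda>x. vertical_div H x y) x)"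
    unfolding px sum_distrib_left by (rule sum.swap)
  moreover have "(\<Sum>m\<in>UNIV. \<Sum>j\<in>UNIV. H x y $ j * partial j (\<lambda>y. partial m (\<lambda>y. H x y $ m) y) y)
      = (\<Sum>j\<in>UNIV. H x y $ j * partial j (vertical_div H x) y)"
    unfolding py sum_distrib_left by (rule sum.swap)
  ultimately show ?thesis
    by (simp add: Ricci_curv_def Riemann_curv_def sum.distrib sum_subtractf
        sum_distrib_left[symmetric] horiz_deriv_def)
qed

text \<open>Write \<open>K = H + Q y\<close> and \<open>N\<close> for the vertical divergence of \<open>H\<close>, and let a dot denote
  \<open>y\<close>-derivatives. The three terms of \<open>Ricci_curv_eq\<close> change as follows, by the product rule and
  Euler's theorem:
  \<^item> the divergence in \<open>x\<close> gains \<open>y\<^sup>m \<partial>Q/\<partial>x\<^sup>m\<close>;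
  \<^item> the vertical divergence becomes \<open>N + (n + 1) Q\<close>, and its derivative along the new spray is
    \<open>N\<^bsub>|0\<^esub> - 2 Q N + (n + 1) (Q\<^bsub>|0\<^esub> - 2 Q\<^sup>2)\<close>;
  \<^item> the trace of the square of the vertical Jacobian gains \<open>4 H\<^sup>m Q\<^bsub>.m\<^esub> + 2 Q N + (n + 3) Q\<^sup>2\<close>.

  In the sum the terms \<open>Q N\<close> cancel, twice the gain of the first term combines with \<open>- 4 H\<^sup>m Q\<^bsub>.m\<^esub>\<close>
  to \<open>2 Q\<^bsub>|0\<^esub>\<close>, and \<open>(n - 1) (Q\<^sup>2 - Q\<^bsub>|0\<^esub>)\<close> remains.\<close>

lemma Ricci_curv_projective_change:
  fixes H :: "real^'n::finite \<Rightarrow> real^'n \<Rightarrow> real^'n"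
  assumes "open U" "x \<in> U" "y \<noteq> 0"
    and H: "smooth_on (U \<times> - {0}) (\<lambda>z. H (fst z) (snd z))"
    and Q: "smooth_on (U \<times> - {0}) (\<lambda>z. Q (fst z) (snd z))"
    and H_hom: "\<And>x y t. x \<in> U \<Longrightarrow> y \<noteq> 0 \<Longrightarrow> 0 < t \<Longrightarrow> H x (t *\<^sub>R y) = t\<^sup>2 *\<^sub>R H x y"
    and Q_hom: "\<And>x y t. x \<in> U \<Longrightarrow> y \<noteq> 0 \<Longrightarrow> 0 < t \<Longrightarrow> Q x (t *\<^sub>R y) = t * Q x y"
  shows "Ricci_curv (\<lambda>x y. H x y + Q x y *\<^sub>R y) x y =
    Ricci_curv H x y + (real CARD('n) - 1) * ((Q x y)\<^sup>2 - horiz_deriv H Q x y)"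
proof -
  let ?W = "U \<times> (- {0} :: (real^'n) set)" and ?n = "real CARD('n)"
  define K where "K = (\<lambda>x y. H x y + Q x y *\<^sub>R y)"
  have W: "open ?W" by (rule open_slit[OF assms(1)])
  have xy: "(x, y) \<in> ?W" using assms by auto
  have snd_nth: "smooth_on ?W (\<lambda>z. snd z $ i)" for i
    by (intro smooth_on_nth W smooth_on_linear bounded_linear_snd)
  have "smooth_on ?W (\<lambda>z. H (fst z) (snd z) + (\<chi> i. Q (fst z) (snd z) * snd z $ i))"
    by (intro smooth_on_add smooth_on_vec_lambda smooth_on_mult W H Q snd_nth)
  moreover have "H a b + (\<chi> i. Q a b * b $ i) = K a b" for a b by (simp add: K_def vec_eq_iff)
  ultimately have K: "smooth_on ?W (\<lambda>z. K (fst z) (snd z))" by simp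
  note dH = slice_differentiable[OF smooth_on_nth[OF W H]]
  note dQ = slice_differentiable[OF Q]
  have comp: "(\<lambda>y::real^'n. y $ i) differentiable F" for i F
    using bounded_linear_imp_differentiable bounded_linear_vec_nth by blast

  have Kx: "partial m (\<lambda>x. K x y $ m) x = partial m (\<lambda>x. H x y $ m) x + y $ m * partial m (\<lambda>x. Q x y) x" for m
    using partial_add[OF dH(2)[OF xy] differentiable_mult[OF differentiable_const dQ(2)[OF xy]]]
      partial_cmult[OF dQ(2)[OF xy], of m "y $ m"]
    by (simp add: K_def mult.commute)
  have Ky: "partial s (\<lambda>y. K a y $ m) b =
      partial s (\<lambda>y. H a y $ m) b + partial s (Q a) b * b $ m + (if s = m then Q a b else 0)"
    if "a \<in> U" "b \<noteq> 0" for a b s m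
  proof -
    have ab: "(a, b) \<in> ?W" using that by auto
    show ?thesis
      using partial_add[OF dH(1)[OF ab] differentiable_mult[OF dQ(1)[OF ab] comp], of s m m]
        partial_mult[OF dQ(1)[OF ab] comp, of s m] by (simp add: K_def partial_component)
  qed

  have Q_Euler: "(\<Sum>m\<in>UNIV. b $ m * partial m (Q a) b) = Q a b" if "a \<in> U" "b \<noteq> 0" for a b
    using Euler_homogeneous[of "Q a" b 1] dQ(1) Q_hom that by auto
  have H_Euler: "(\<Sum>m\<in>UNIV. y $ m * partial m (\<lambda>y. H x y $ i) y) = 2 * H x y $ i" for i
    using Euler_homogeneous[of "\<lambda>y. H x y $ i" y 2] dH(1) H_hom assms by auto

  let ?N = "vertical_div H"
  have N: "smooth_on ?W (\<lambda>z. ?N (fst z) (snd z))" by (rule smooth_on_vertical_div[OF W H])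
  have N_Euler: "(\<Sum>m\<in>UNIV. y $ m * partial m (?N x) y) = ?N x y"
    using Euler_homogeneous[of "?N x" y 1] slice_differentiable(1)[OF N xy]
      vertical_div_homogeneous[OF assms(1) H H_hom assms(2,3)] by auto

  have divK: "vertical_div K a b = ?N a b + (?n + 1) * Q a b" if "a \<in> U" "b \<noteq> 0" for a b
    using Q_Euler[OF that] Ky[OF that]
    by (simp add: vertical_div_def sum.distrib algebra_simps)
  have "horiz_deriv K (vertical_div K) x y = horiz_deriv K (\<lambda>x y. ?N x y + (?n + 1) * Q x y) x y"
    by (rule horiz_deriv_cong[of U "- {0}"]) (use assms divK in auto)
  also have "\<dots> = horiz_deriv K ?N x y + (?n + 1) * horiz_deriv K Q x y"
    by (rule horiz_deriv_add_cmult[OF N Q xy])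
  finally have hdK: "horiz_deriv K (vertical_div K) x y =
      horiz_deriv H ?N x y - 2 * Q x y * ?N x y
      + (?n + 1) * (horiz_deriv H Q x y - 2 * (Q x y)\<^sup>2)"
    unfolding K_def horiz_deriv_change_spray N_Euler Q_Euler[OF assms(2,3)]
    by (simp add: power2_eq_square)

  \<comment> \<open>The Jacobian of \<open>Q y\<close> is the rank one matrix \<open>y\<^sup>m Q\<^bsub>.s\<^esub>\<close> plus \<open>Q\<close> times the identity; every
      product of the rank one part with another factor contracts \<open>y\<close> with a \<open>y\<close>-derivative.\<close>
  let ?h = "\<lambda>s m. partial s (\<lambda>y. H x y $ m) y" and ?q = "\<lambda>s. partial s (Q x) y"
  have QE: "(\<Sum>m\<in>UNIV. y $ m * ?q m) = Q x y" by (rule Q_Euler[OF assms(2,3)])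
  have "(\<Sum>m\<in>UNIV. \<Sum>s\<in>UNIV. partial s (\<lambda>y. K x y $ m) y * partial m (\<lambda>y. K x y $ s) y)
    = (\<Sum>m\<in>UNIV. \<Sum>s\<in>UNIV. ?h s m * ?h m s
        + ?q m * (y $ s * ?h s m) + ?q s * (y $ m * ?h m s)
        + (y $ m * ?q m) * (y $ s * ?q s)
        + (if s = m then 2 * Q x y * (?h m m + y $ m * ?q m) + (Q x y)\<^sup>2 else 0))"
    by (intro sum.cong refl) (auto simp: Ky[OF assms(2,3)] algebra_simps power2_eq_square)
  also have "\<dots> = (\<Sum>m\<in>UNIV. \<Sum>s\<in>UNIV. ?h s m * ?h m s)
        + (\<Sum>m\<in>UNIV. ?q m * (\<Sum>s\<in>UNIV. y $ s * ?h s m))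
        + (\<Sum>s\<in>UNIV. ?q s * (\<Sum>m\<in>UNIV. y $ m * ?h m s))
        + (\<Sum>m\<in>UNIV. y $ m * ?q m) * (\<Sum>s\<in>UNIV. y $ s * ?q s)
        + 2 * Q x y * (?N x y + (\<Sum>m\<in>UNIV. y $ m * ?q m)) + ?n * (Q x y)\<^sup>2"
  proof -
    have "(\<Sum>m\<in>UNIV. \<Sum>s\<in>UNIV. ?q m * (y $ s * ?h s m)) = (\<Sum>m\<in>UNIV. ?q m * (\<Sum>s\<in>UNIV. y $ s * ?h s m))"
      by (simp only: sum_distrib_left)
    moreover have "(\<Sum>m\<in>UNIV. \<Sum>s\<in>UNIV. ?q s * (y $ m * ?h m s)) = (\<Sum>s\<in>UNIV. ?q s * (\<Sum>m\<in>UNIV. y $ m * ?h m s))"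
      unfolding sum_distrib_left by (rule sum.swap)
    moreover have "(\<Sum>m\<in>UNIV. \<Sum>s\<in>UNIV. (y $ m * ?q m) * (y $ s * ?q s))
        = (\<Sum>m\<in>UNIV. y $ m * ?q m) * (\<Sum>s\<in>UNIV. y $ s * ?q s)"
      by (simp only: sum_product)
    moreover have "(\<Sum>m\<in>UNIV. \<Sum>s\<in>UNIV. if s = m then 2 * Q x y * (?h m m + y $ m * ?q m) + (Q x y)\<^sup>2 else 0)
        = 2 * Q x y * (?N x y + (\<Sum>m\<in>UNIV. y $ m * ?q m)) + ?n * (Q x y)\<^sup>2"
      by (simp add: sum.distrib sum_distrib_left[symmetric] vertical_div_def)
    ultimately show ?thesis by (simp only: sum.distrib[where 'a = real] add.assoc)
  qed
  also have "\<dots> = (\<Sum>m\<in>UNIV. \<Sum>s\<in>UNIV. ?h s m * ?h m s)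
        + 4 * (\<Sum>m\<in>UNIV. H x y $ m * ?q m) + 2 * Q x y * ?N x y + (?n + 3) * (Q x y)\<^sup>2"
    unfolding QE H_Euler by (simp add: algebra_simps sum_distrib_left power2_eq_square)
  finally have trK: "(\<Sum>m\<in>UNIV. \<Sum>s\<in>UNIV. partial s (\<lambda>y. K x y $ m) y * partial m (\<lambda>y. K x y $ s) y)
    = (\<Sum>m\<in>UNIV. \<Sum>s\<in>UNIV. ?h s m * ?h m s)
        + 4 * (\<Sum>m\<in>UNIV. H x y $ m * ?q m) + 2 * Q x y * ?N x y + (?n + 3) * (Q x y)\<^sup>2" .

  have "Ricci_curv K x y = Ricci_curv H x y + (?n - 1) * ((Q x y)\<^sup>2 - horiz_deriv H Q x y)"
    unfolding Ricci_curv_eq[OF W K xy] Ricci_curv_eq[OF W H xy] hdK trK Kx sum.distrib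
    by (simp add: horiz_deriv_def[of H Q] algebra_simps)
  then show ?thesis by (simp add: K_def)
qed

section \<open>The S-curvature\<close>

lemma smooth_on_S_curv:
  fixes H :: "real^'n::finite \<Rightarrow> real^'n \<Rightarrow> real^'n"
  assumes "open U" and H: "smooth_on (U \<times> - {0}) (\<lambda>z. H (fst z) (snd z))"
    and s: "smooth_on U s" "\<And>x. x \<in> U \<Longrightarrow> 0 < s x"
  shows "smooth_on (U \<times> - {0}) (\<lambda>z. S_curv H s (fst z) (snd z))"
proof -
  let ?W = "U \<times> (- {0} :: (real^'n) set)"
  have W: "open ?W" by (rule open_slit[OF assms(1)])
  have "smooth_on U (\<lambda>x. partial m (\<lambda>x. ln (s x)) x)" for m
    unfolding partial_def by (intro smooth_on_derivative smooth_on_ln assms)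
  then have "smooth_on ?W (\<lambda>z. partial m (\<lambda>x. ln (s x)) (fst z))" for m
    by (intro smooth_on_compose_linear[OF bounded_linear_fst W, of U]) auto
  then have "smooth_on ?W (\<lambda>z. vertical_div H (fst z) (snd z) +
      (- 1) * (\<Sum>m\<in>UNIV. snd z $ m * partial m (\<lambda>x. ln (s x)) (fst z)))"
    by (intro smooth_on_add smooth_on_mult smooth_on_const smooth_on_sum smooth_on_nth W
        smooth_on_vertical_div[OF W H] smooth_on_linear[OF bounded_linear_snd W])
  then show ?thesis by (simp add: S_curv_def vertical_div_def)
qed

lemma S_curv_homogeneous:
  fixes H :: "real^'n::finite \<Rightarrow> real^'n \<Rightarrow> real^'n"
  assumes "open U" and H: "smooth_on (U \<times> - {0}) (\<lambda>z. H (fst z) (snd z))"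
    and H_hom: "\<And>x y t. x \<in> U \<Longrightarrow> y \<noteq> 0 \<Longrightarrow> 0 < t \<Longrightarrow> H x (t *\<^sub>R y) = t\<^sup>2 *\<^sub>R H x y"
    and "x \<in> U" "y \<noteq> 0" "0 < t"
  shows "S_curv H s x (t *\<^sub>R y) = t * S_curv H s x y"
  using vertical_div_homogeneous[OF assms]
  by (simp add: S_curv_def vertical_div_def sum_distrib_left algebra_simps)

lemma PRic_curv_eq:
  fixes H :: "real^'n::finite \<Rightarrow> real^'n \<Rightarrow> real^'n"
  assumes "open U" "x \<in> U" "y \<noteq> 0"
    and H: "smooth_on (U \<times> - {0}) (\<lambda>z. H (fst z) (snd z))"
    and H_hom: "\<And>x y t. x \<in> U \<Longrightarrow> y \<noteq> 0 \<Longrightarrow> 0 < t \<Longrightarrow> H x (t *\<^sub>R y) = t\<^sup>2 *\<^sub>R H x y"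
    and s: "smooth_on U s" "\<And>x. x \<in> U \<Longrightarrow> 0 < s x"
  defines "P \<equiv> \<lambda>x y. S_curv H s x y / (real CARD('n) + 1)"
  shows "PRic_curv H s x y =
    Ricci_curv H x y + (real CARD('n) - 1) * (horiz_deriv H P x y + (P x y)\<^sup>2)"
proof -
  let ?W = "U \<times> (- {0} :: (real^'n) set)"
  have W: "open ?W" by (rule open_slit[OF assms(1)])
  \<comment> \<open>The summand 0 gives \<open>Q\<close> the shape required by \<open>horiz_deriv_add_cmult\<close>.\<close>
  define Q where "Q = (\<lambda>x y. 0 + (- 1) * P x y)"
  have "smooth_on ?W (\<lambda>z. (1 / (real CARD('n) + 1)) * S_curv H s (fst z) (snd z))"
    by (intro smooth_on_mult smooth_on_const smooth_on_S_curv assms W)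
  then have P: "smooth_on ?W (\<lambda>z. P (fst z) (snd z))" by (simp add: P_def)
  then have Q: "smooth_on ?W (\<lambda>z. Q (fst z) (snd z))" 
    unfolding Q_def by (intro smooth_on_add smooth_on_mult smooth_on_const W)
  have "Q x (t *\<^sub>R y) = t * Q x y" if "x \<in> U" "y \<noteq> 0" "0 < t" for x y t
    using S_curv_homogeneous[OF assms(1) H H_hom that] by (simp add: Q_def P_def)
  from Ricci_curv_projective_change[OF assms(1-3) H Q H_hom this]
  have "Ricci_curv (\<lambda>x y. H x y + Q x y *\<^sub>R y) x y =
      Ricci_curv H x y + (real CARD('n) - 1) * ((Q x y)\<^sup>2 - horiz_deriv H Q x y)" by blast
  moreover have "horiz_deriv H Q x y = - horiz_deriv H P x y"
    using horiz_deriv_add_cmult[OF smooth_on_const P, of x y H 0 "- 1"] assms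
    by (simp add: Q_def horiz_deriv_def partial_const)
  moreover have "PRic_curv H s = Ricci_curv (\<lambda>x y. H x y + Q x y *\<^sub>R y)"
    by (simp add: PRic_curv_def proj_spray_coeffs_def[abs_def] Q_def P_def)
  ultimately show ?thesis by (simp add: Q_def)
qed

text \<open>The factor \<open>n + 1\<close> in the exponent cancels the denominator in the definition of \<open>\<Xi>\<close>, so that
  exactly \<open>f\<^sub>0\<close> is subtracted.\<close>

lemma Xi_eq_S_curv_weighted:
  fixes H :: "real^'n::finite \<Rightarrow> real^'n \<Rightarrow> real^'n"
  assumes "open U" "x \<in> U" "smooth_on U h" "smooth_on U s" "\<And>x. x \<in> U \<Longrightarrow> 0 < s x"
  shows "Xi H s h x y =
    S_curv H (\<lambda>x. exp ((real CARD('n) + 1) * h x) * s x) x y / (real CARD('n) + 1)"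
proof -
  let ?c = "real CARD('n) + 1"
  have d: "h differentiable (at x)" "(\<lambda>x. ln (s x)) differentiable (at x)"
    using assms smooth_on_differentiable smooth_on_ln by blast+
  have "partial m (\<lambda>x. ln (exp (?c * h x) * s x)) x = partial m (\<lambda>x. ?c * h x + ln (s x)) x" for m
    by (rule partial_cong[OF assms(1,2)]) (simp add: ln_mult assms(5)[THEN less_imp_neq, THEN not_sym])
  also have "\<dots> m = ?c * partial m h x + partial m (\<lambda>x. ln (s x)) x" for m
    using d by (simp add: partial_add partial_cmult)
  finally have "S_curv H (\<lambda>x. exp (?c * h x) * s x) x y = S_curv H s x y - ?c * d0 h x y"
    by (simp add: S_curv_def d0_def sum.distrib sum_distrib_left algebra_simps)
  then show ?thesis by (simp add: Xi_def diff_divide_distrib)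
qed

text \<open>The coordinate form of the theorem: the right-hand side vanishes if and only if \<open>Ric\<close> satisfies
  the equation with \<open>\<Xi>\<close>.\<close>

lemma PRic_curv_weighted_eq:
  fixes H :: "real^'n::finite \<Rightarrow> real^'n \<Rightarrow> real^'n"
  assumes "open U" "x \<in> U" "y \<noteq> 0"
    and H: "smooth_on (U \<times> - {0}) (\<lambda>z. H (fst z) (snd z))"
    and H_hom: "\<And>x y t. x \<in> U \<Longrightarrow> y \<noteq> 0 \<Longrightarrow> 0 < t \<Longrightarrow> H x (t *\<^sub>R y) = t\<^sup>2 *\<^sub>R H x y"
    and s: "smooth_on U s" "\<And>x. x \<in> U \<Longrightarrow> 0 < s x" and h: "smooth_on U h"
  shows "PRic_curv H (\<lambda>x. exp ((real CARD('n) + 1) * h x) * s x) x y =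
    Ricci_curv H x y + (real CARD('n) - 1) * (horiz_deriv H (Xi H s h) x y + (Xi H s h x y)\<^sup>2)"
proof -
  let ?s = "\<lambda>x. exp ((real CARD('n) + 1) * h x) * s x"
  let ?P = "\<lambda>x y. S_curv H ?s x y / (real CARD('n) + 1)"
  have s': "smooth_on U ?s"
    by (intro smooth_on_mult smooth_on_exp smooth_on_const assms)
  have Xi: "Xi H s h x y = ?P x y" if "x \<in> U" for x y
    using Xi_eq_S_curv_weighted[OF assms(1) that h s] .
  have "horiz_deriv H (Xi H s h) x y = horiz_deriv H ?P x y"
    by (rule horiz_deriv_cong[of U "- {0}"]) (use assms Xi in auto)
  then show ?thesis
    using PRic_curv_eq[OF assms(1-3) H H_hom s'] s(2) Xi[OF assms(2)] by simp
qed

section \<open>Sprays and volume forms on manifolds\<close>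

lemma smooth_on_spray_coeffs:
  fixes A :: "('a, real^'n::finite) chart set"
  assumes "smooth_manifold M A" "is_spray A G" "c \<in> A"
  shows "smooth_on (chart_img c \<times> - {0}) (\<lambda>z. spray_coeffs A G c (fst z) (snd z))"
proof -
  have "open (chart_img c)" using assms unfolding smooth_manifold_def is_chart_def by blast
  then have W: "open (chart_img c \<times> (- {0} :: (real^'n) set))" by (rule open_slit)
  have "smooth_on (chart_img c \<times> - {0}) (field_coords G (induced_chart A c))"
    using assms(2,3) induced_chart_img[OF assms(1,3)]
    unfolding is_spray_def smooth_vector_field_def slit_atlas_def by auto
  moreover have "bounded_linear (\<lambda>w. - (1/2) *\<^sub>R snd w :: real^'n)"
    by (intro bounded_linear_scaleR_right bounded_linear_compose[OF bounded_linear_scaleR_right]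
        bounded_linear_snd)
  ultimately show ?thesis
    using smooth_on_bounded_linear[OF _ W] by (fastforce simp: spray_coeffs_def)
qed

lemma spray_coeffs_homogeneous:
  fixes A :: "('a, real^'n::finite) chart set"
  assumes "smooth_manifold M A" "is_spray A G" "c \<in> A" "x \<in> chart_img c" "y \<noteq> 0" "0 < t"
  shows "spray_coeffs A G c x (t *\<^sub>R y) = t\<^sup>2 *\<^sub>R spray_coeffs A G c x y"
proof -
  have "(x, y) \<in> chart_img (induced_chart A c)"
    using induced_chart_img[OF assms(1,3)] assms(4,5) by simp
  then show ?thesis using assms(2,3,6) unfolding is_spray_def by blast
qed

text \<open>The weight is the expression of a function on the manifold, so it takes the same value in all
  charts around a point and leaves the transformation law of the densities intact.\<close>

lemma volume_form_weighted:
  fixes A :: "('a, real^'n::finite) chart set"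
  assumes "smooth_manifold M A" "volume_form A \<sigma>" "smooth_function A f"
  shows "volume_form A (\<lambda>c x. exp (r * (f \<circ> chart_inv c) x) * \<sigma> c x)"
proof -
  have ch: "is_chart M c" if "c \<in> A" for c using assms(1) that unfolding smooth_manifold_def by blast
  have smooth: "smooth_on (chart_img c) (\<lambda>x. exp (r * (f \<circ> chart_inv c) x) * \<sigma> c x)" if "c \<in> A" for c
  proof -
    have "open (chart_img c)" using ch[OF that] unfolding is_chart_def by blast
    moreover have "smooth_on (chart_img c) (f \<circ> chart_inv c)" "smooth_on (chart_img c) (\<sigma> c)"
      using assms that unfolding volume_form_def smooth_function_def by blast+
    ultimately show ?thesis by (intro smooth_on_mult smooth_on_exp smooth_on_const)
  qed
  have pos: "0 < exp (r * (f \<circ> chart_inv c) x) * \<sigma> c x" if "c \<in> A" "x \<in> chart_img c" for c x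
    using assms(2) that unfolding volume_form_def by simp
  have density: "exp (r * (f \<circ> chart_inv c) (chart_map c p)) * \<sigma> c (chart_map c p) =
      \<bar>det (matrix (frechet_derivative (transition c d) (at (chart_map c p))))\<bar> *
      (exp (r * (f \<circ> chart_inv d) (chart_map d p)) * \<sigma> d (chart_map d p))"
    if "c \<in> A" "d \<in> A" "p \<in> chart_dom c \<inter> chart_dom d" for c d p
  proof -
    have "\<sigma> c (chart_map c p) =
        \<bar>det (matrix (frechet_derivative (transition c d) (at (chart_map c p))))\<bar> *
        \<sigma> d (chart_map d p)"
      using assms(2) that unfolding volume_form_def by blast
    moreover have "chart_inv c (chart_map c p) = p" "chart_inv d (chart_map d p) = p"
      using chart_inv_map[OF ch] that by auto
    ultimately show ?thesis by simp
  qed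
  show ?thesis
    unfolding volume_form_def by (intro conjI ballI smooth pos density)
qed

theorem theorem1p2:
  fixes M :: "'a topology"
    and A :: "('a, real^'n::finite) chart set"
    and G :: "('a, 'n) slit_field"
  assumes "smooth_manifold M A"
    and "is_spray A G"
  shows "projectively_Ricci_flat A G \<longleftrightarrow>
    (\<exists>\<sigma> f. volume_form A \<sigma> \<and> smooth_function A f \<and>
      (\<forall>c\<in>A. \<forall>(x, y) \<in> chart_img (induced_chart A c).
        let H = spray_coeffs A G c;
            \<Xi> = Xi H (\<sigma> c) (f \<circ> chart_inv c)
        in Ricci_curv H x y =
             - (real CARD('n) - 1) * (horiz_deriv H \<Xi> x y + (\<Xi> x y)\<^sup>2)))"
    (is "_ \<longleftrightarrow> (\<exists>\<sigma> f. volume_form A \<sigma> \<and> smooth_function A f \<and> ?eq \<sigma> f)")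
proof -
  let ?w = "\<lambda>\<sigma> f c x. exp ((real CARD('n) + 1) * (f \<circ> chart_inv c) x) * \<sigma> c x"
  have key: "?eq \<sigma> f \<longleftrightarrow> (\<forall>c\<in>A. \<forall>(x, y) \<in> chart_img (induced_chart A c).
      PRic_curv (spray_coeffs A G c) (?w \<sigma> f c) x y = 0)"
    if vf: "volume_form A \<sigma>" "smooth_function A f" for \<sigma> f
  proof (intro ball_cong refl, clarify)
    fix c x y assume c: "c \<in> A" and "(x, y) \<in> chart_img (induced_chart A c)"
    then have xy: "x \<in> chart_img c" "y \<noteq> 0" using induced_chart_img[OF assms(1) c] by auto
    have "open (chart_img c)" using assms c unfolding smooth_manifold_def is_chart_def by blast
    from PRic_curv_weighted_eq[OF this xy smooth_on_spray_coeffs[OF assms c]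
        spray_coeffs_homogeneous[OF assms c], of "\<sigma> c" "f \<circ> chart_inv c"]
    show "(let H = spray_coeffs A G c; \<Xi> = Xi H (\<sigma> c) (f \<circ> chart_inv c)
        in Ricci_curv H x y = - (real CARD('n) - 1) * (horiz_deriv H \<Xi> x y + (\<Xi> x y)\<^sup>2)) \<longleftrightarrow>
      PRic_curv (spray_coeffs A G c) (?w \<sigma> f c) x y = 0"
      using vf c unfolding volume_form_def smooth_function_def Let_def
      by (auto simp: algebra_simps eq_neg_iff_add_eq_0)
  qed
  show ?thesis
  proof
    assume "projectively_Ricci_flat A G"
    then obtain \<sigma> where \<sigma>: "volume_form A \<sigma>" "\<forall>c\<in>A. \<forall>(x, y) \<in> chart_img (induced_chart A c).
        PRic_curv (spray_coeffs A G c) (\<sigma> c) x y = 0"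
      unfolding projectively_Ricci_flat_def by blast
    have f: "smooth_function A (\<lambda>_. 0)"
      by (simp add: smooth_function_def comp_def smooth_on_const)
    have "?eq \<sigma> (\<lambda>_. 0)" unfolding key[OF \<sigma>(1) f] using \<sigma>(2) by simp
    then show "\<exists>\<sigma> f. volume_form A \<sigma> \<and> smooth_function A f \<and> ?eq \<sigma> f" using \<sigma>(1) f by blast
  next
    assume "\<exists>\<sigma> f. volume_form A \<sigma> \<and> smooth_function A f \<and> ?eq \<sigma> f"
    then obtain \<sigma> f where "volume_form A \<sigma>" "smooth_function A f" "?eq \<sigma> f" by blast
    then show "projectively_Ricci_flat A G"
      unfolding projectively_Ricci_flat_def
      using key volume_form_weighted[OF assms(1)] by blast
  qed
qed

end
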